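(* Let $K\subseteq\mathbb{R}^n$ be a convex set, let $\gamma\ge0$, and let $h:K\to\mathbb{R}$ be a differentiable function. If $h$ is strongly quasiconvex with modulus $\gamma$, then for every $x,y\in K$, $$\langle\nabla h(x),y-x\rangle>-\frac{\gamma}{2}\|y-x\|^2\ \Longrightarrow\ \langle\nabla h(y),x-y\rangle\le-\frac{\gamma}{2}\|y-x\|^2.$$
   Context: $\langle\cdot,\cdot\rangle$ and $\|\cdot\|$ denote the Euclidean inner product and norm on $\mathbb{R}^n$. A function $h$ is strongly quasiconvex on a convex set $K$ with modulus $\gamma\ge0$ if for all $x,y\in K$ and all $\lambda\in[0,1]$, $$h(\lambda y+(1-\lambda)x)\le\max\{h(y),h(x)\}-\lambda(1-\lambda)\frac{\gamma}{2}\|x-y\|^2$$ (for $\gamma=0$ this is ordinary quasiconvexity). *)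

theory Defs
  imports "HOL-Analysis.Analysis"
begin

definition strongly_quasiconvex_on ::
    "'a::real_normed_vector set \<Rightarrow> real \<Rightarrow> ('a \<Rightarrow> real) \<Rightarrow> bool" where
  "strongly_quasiconvex_on K \<gamma> h \<longleftrightarrow>
     (\<forall>x\<in>K. \<forall>y\<in>K. \<forall>t\<in>{0..1}.
        h (t *\<^sub>R y + (1 - t) *\<^sub>R x)
          \<le> max (h y) (h x) - t * (1 - t) * (\<gamma> / 2) * (norm (x - y))\<^sup>2)"

text \<open>
  A relative version of the library's \<open>gderiv\<close>: \<open>D\<close> is a gradient of \<open>h\<close> at \<open>x\<close> when \<open>h\<close> is
  regarded as a function on \<open>K\<close> only.  At interior points of \<open>K\<close> this agrees with \<open>gderiv\<close>.
  If \<open>K\<close> is contained in a proper affine subspace, \<open>D\<close> is determined only up to vectors orthogonal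
  to its directions, but for convex \<open>K\<close> and \<open>y \<in> K\<close> the value \<open>D \<bullet> (y - x)\<close> is unique.
\<close>

definition has_gradient_within ::
    "('a::real_inner \<Rightarrow> real) \<Rightarrow> 'a \<Rightarrow> 'a \<Rightarrow> 'a set \<Rightarrow> bool" where
  "has_gradient_within h D x K \<longleftrightarrow> (h has_derivative (\<lambda>v. D \<bullet> v)) (at x within K)"

end

theory Submission
  imports Defs
begin

text \<open>
  Strong quasiconvexity along the segment from \<open>x\<close> to \<open>y\<close> bounds the difference quotient of \<open>h\<close> at
  \<open>x\<close> by \<open>-(1 - t) * (\<gamma> / 2) * (norm (y - x))\<^sup>2\<close> as soon as \<open>h y \<le> h x\<close>; let \<open>t\<close> tend to \<open>0\<close>.
  The premise of the theorem therefore forces \<open>h x < h y\<close>, and the same bound with \<open>x\<close> and \<open>y\<close>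
  exchanged is the conclusion.
\<close>

text \<open>Chain rule along the affine path from \<open>x\<close> to \<open>y\<close>. The
  derivative at 0 is one-sided because convexity keeps the path in \<open>K\<close> only for
  parameters in \<open>{0..1}\<close>, and \<open>D\<close> is a gradient relative to
  \<open>K\<close>.\<close>

lemma has_gradient_within_segment:
  assumes "convex K" "x \<in> K" "y \<in> K" "has_gradient_within h D x K"
  shows "((\<lambda>t. h (t *\<^sub>R y + (1 - t) *\<^sub>R x)) has_real_derivative D \<bullet> (y - x)) (at 0 within {0..1})"
proof -
  define p where "p t = t *\<^sub>R y + (1 - t) *\<^sub>R x" for t :: real
  have "p ` {0..1} \<subseteq> K"
    using convexD[OF assms(1) assms(3,2)] by (auto simp: p_def)
  then have "(h has_derivative (\<lambda>v. D \<bullet> v)) (at (p 0) within p ` {0..1})"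
    using assms(4) by (auto simp: p_def has_gradient_within_def intro: has_derivative_subset)
  moreover have "(p has_derivative (\<lambda>s. s *\<^sub>R (y - x))) (at 0 within {0..1})"
    unfolding p_def by (auto intro!: derivative_eq_intros simp: algebra_simps)
  ultimately have "((\<lambda>t. h (p t)) has_derivative (\<lambda>s. D \<bullet> (s *\<^sub>R (y - x)))) (at 0 within {0..1})"
    by (rule has_derivative_in_compose[rotated])
  then show ?thesis
    by (simp add: p_def has_field_derivative_def mult.commute[of _ "D \<bullet> (y - x)"])
qed

lemma strongly_quasiconvex_on_gradient_le:
  assumes "convex K" "x \<in> K" "y \<in> K" "has_gradient_within h D x K"
    and "strongly_quasiconvex_on K \<gamma> h" and "h y \<le> h x"
  shows "D \<bullet> (y - x) \<le> - (\<gamma> / 2) * (norm (y - x))\<^sup>2"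
proof -
  define c where "c = (\<gamma> / 2) * (norm (y - x))\<^sup>2"
  define q where "q t = (h (t *\<^sub>R y + (1 - t) *\<^sub>R x) - h x) / t" for t
  let ?F = "at (0::real) within {0..1}"
  have "(q \<longlongrightarrow> D \<bullet> (y - x)) ?F"
    using has_gradient_within_segment[OF assms(1-4)]
    by (simp add: has_field_derivative_iff q_def[abs_def])
  moreover have "((\<lambda>t. - (1 - t) * c) \<longlongrightarrow> - (1 - 0) * c) ?F"
    by (intro tendsto_intros)
  \<comment> \<open>The bound holds at every nonzero \<open>t\<close> in \<open>{0..1}\<close>, so
    no smaller neighbourhood of 0 has to be chosen.\<close>
  moreover have "\<forall>\<^sub>F t in ?F. q t \<le> - (1 - t) * c"
    unfolding eventually_at_filter
  proof (intro always_eventually allI impI)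
    fix t :: real
    assume "t \<noteq> 0" and t: "t \<in> {0..1}"
    then have "0 < t" by simp
    have "h (t *\<^sub>R y + (1 - t) *\<^sub>R x)
        \<le> max (h y) (h x) - t * (1 - t) * (\<gamma> / 2) * (norm (x - y))\<^sup>2"
      using assms(2,3,5) t unfolding strongly_quasiconvex_on_def by blast
    \<comment> \<open>As \<open>h y \<le> h x\<close>, the maximum is \<open>h x\<close>; the factor
      \<open>t\<close> is put last, ready for the division in \<open>q\<close>.\<close>
    then have "h (t *\<^sub>R y + (1 - t) *\<^sub>R x) - h x \<le> - (1 - t) * c * t"
      using assms(6) by (simp add: c_def norm_minus_commute max_absorb2 field_simps)
    then show "q t \<le> - (1 - t) * c"
      using \<open>0 < t\<close> by (simp add: q_def pos_divide_le_eq)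
  qed
  \<comment> \<open>An inequality passes to the limit only along a nontrivial filter: 0 is a limit
    point of \<open>{0..1}\<close>.\<close>
  moreover have "?F \<noteq> bot"
    by (simp add: trivial_limit_within islimpt_Icc)
  ultimately have "D \<bullet> (y - x) \<le> - (1 - 0) * c"
    using tendsto_le by blast
  then show ?thesis
    by (simp add: c_def)
qed

theorem proposition9:
  fixes K :: "(real ^ 'n) set"
    and \<gamma> :: real
    and h :: "real ^ 'n \<Rightarrow> real"
    and grad :: "real ^ 'n \<Rightarrow> real ^ 'n"
  assumes "convex K"
    and "\<gamma> \<ge> 0"
    and "\<And>x. x \<in> K \<Longrightarrow> has_gradient_within h (grad x) x K"
    and "strongly_quasiconvex_on K \<gamma> h"
  shows "\<forall>x\<in>K. \<forall>y\<in>K.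
           grad x \<bullet> (y - x) > - (\<gamma> / 2) * (norm (y - x))\<^sup>2 \<longrightarrow>
           grad y \<bullet> (x - y) \<le> - (\<gamma> / 2) * (norm (y - x))\<^sup>2"
proof (intro ballI impI)
  fix x y
  assume x: "x \<in> K" and y: "y \<in> K"
    and "grad x \<bullet> (y - x) > - (\<gamma> / 2) * (norm (y - x))\<^sup>2"
  \<comment> \<open>By contradiction: \<open>h y < h x\<close> would give the bound that the premise
    denies. The weak inequality is all that the exchanged application asks for.\<close>
  then have "h x \<le> h y"
    using strongly_quasiconvex_on_gradient_le[OF assms(1) x y assms(3)[OF x] assms(4)] by linarith
  then show "grad y \<bullet> (x - y) \<le> - (\<gamma> / 2) * (norm (y - x))\<^sup>2"
    using strongly_quasiconvex_on_gradient_le[OF assms(1) y x assms(3)[OF y] assms(4)]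
    by (simp add: norm_minus_commute)
qed

end
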